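(* Let $D$ be an oriented diagram, with $n$ crossings, of an oriented knot $K\subset S^3$, let $M$ be the exterior of $K$ with two open balls removed, and let region variables satisfying the gluing equations of $\mathcal T_5$ be given. Let $q_1,\dots,q_n\in\mathbb C^*/\{\pm1\}$ satisfy the $q$-relations up to sign for all segments of $D$, and let $\mathcal B_i:e(\overline o_i)\to\mathrm{SL}(2,\mathbb C)$ $(1\le i\le n)$ be the corresponding natural cocycles on the truncated octahedra. Then the $\mathcal B_i$ are well-glued after projecting them to $\mathrm{PSL}(2,\mathbb C)$: whenever edges of the truncated octahedra are identified in $M$, the corresponding matrices agree in $\mathrm{PSL}(2,\mathbb C)$. In particular, they form a natural cocycle $\mathcal B:e(M)\to\mathrm{PSL}(2,\mathbb C)$.
   Context: **Labels at a crossing.** The diagram is viewed from above. A segment of $D$ is an edge of $D$ regarded as a 4-valent graph; a region is a complementary face. At a crossing (positive or negative) let $a$ be the incoming under-segment and $a,b,c,d$ the four segments in counterclockwise order; so $c$ is the outgoing under-segment and $b,d$ are over-segments. Region variables there are $w_a$ (region at the corner between $a$ and $b$), $w_b$ (between $b$ and $c$), $w_c$ (between $c$ and $d$), $w_d$ (between $d$ and $a$). **Octahedral decomposition and $\mathcal T_5$.** Let $p\ne q$ be two points of $S^3\setminus K$ (above and below the diagram). $S^3\setminus(K\cup\{p,q\})$ is a union of ideal octahedra $o_1,\dots,o_n$, one per crossing. The octahedron at a crossing has top vertex $v_\infty$ on the over-strand, bottom vertex $v_0$ on the under-strand, and side vertices $v_a,v_b,v_c,v_d$ in the directions of $a,b,c,d$.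 The vertices $v_a,v_c$ are at $p$, and $v_b,v_d$ are at $q$; $v_0,v_\infty$ are at the knot. Every face has one vertex of each type (knot, $p$, $q$). For each segment $s$ and each of its two sides, at each end of $s$ take the face spanned by $v_\infty$ if $s$ is over there ($v_0$ if $s$ is under there), $v_s$, and the neighbouring side vertex on that side of $s$; the two faces so obtained from the two ends of $s$ are glued, matching vertex types. $\mathcal T_5$ is obtained by dividing each octahedron into the five tetrahedra $v_\infty v_av_bv_c,\ v_\infty v_av_cv_d,\ v_0v_bv_cv_d,\ v_0v_av_bv_d,\ v_av_bv_cv_d$. Truncating decomposes $M$ into truncated tetrahedra; $e(M)$ and $e(\overline o_i)$ denote the oriented edges of $M$ and of the truncated octahedron $\overline o_i$ (so subdivided). Edges in the boundary (around truncated vertices) are short-edges, the others long-edges. **Region variables and gluing equations of $\mathcal T_5$.** Nonzero complex numbers assigned to regions, distinct for two regions sharing a segment, with $w_aw_c\ne w_bw_d$ at each crossing. For a corner $\kappa$ of a region with variable $w$, let $w',w''$ be the two variables of the regions adjacent to it at that crossing and $w^*$ that of the opposite corner; let $f(\kappa)=\frac{(w'-w)(w''-w)}{w'w''-ww^*}$. Let $\tau(\kappa)=f(\kappa)$ if going counterclockwise about the crossing through the corner leads from the over- to the under-strand, and $\tau(\kappa)=f(\kappa)^{-1}$ otherwise. The equation for a region is $\prod_\kappa\tau(\kappa)=1$ over its corners. **The $q$-relations.** The $\eta$-value at a crossing is $\eta=w_bw_d-w_aw_c$ if it is positive and $\eta=w_aw_c-w_bw_d$ if it is negative; $\eta_i$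 is its value at the crossing of $o_i$. For a segment drawn from left to right, with $i,j$ the indices of the octahedra at its left and right end and $w_C,w_D$ the variables of the two regions on its two sides, the relation is, up to sign: - over at left, under at right: $\frac{q_i}{q_j}=\frac{w_C-w_D}{\sqrt{\eta_j}}$; - under at left, over at right: $\frac{q_i}{q_j}=\frac{\sqrt{\eta_i}}{w_C-w_D}$; - over at both: $\frac{q_i}{q_j}=1$; - under at both: $\frac{q_i}{q_j}=\frac{\sqrt{\eta_i}}{\sqrt{\eta_j}}$. **Natural cocycles.** $P$ is the group of upper triangular matrices with ones on the diagonal. A natural $(G,P)$-cocycle ($G=\mathrm{SL}(2,\mathbb C)$ or $\mathrm{PSL}(2,\mathbb C)$) assigns to oriented edges $e$ elements $\mathcal B(e)\in G$ with $\mathcal B(e)\mathcal B(-e)=I$, product $I$ around every (triangular or hexagonal) face, $\mathcal B(e)\in P$ on short-edges, and $\mathcal B(e)$ counter-diagonal on long-edges. **The cocycle $\mathcal B_i$.** At the crossing of $o_i$ let $\epsilon=+1$ if it is positive and $\epsilon=-1$ if it is negative, and define vectors in $\mathbb C^2$: $V_a=q_i\binom01,\ V_c=q_i\binom{\epsilon}{1},\ V_b=\frac1{q_i}\binom{\epsilon w_a}{w_a-w_b},\ V_d=\frac1{q_i}\binom{\epsilon w_d}{w_d-w_c},\ V_\infty=\binom10,\ V_0=\frac1{\sqrt{\eta_i}}\binom{\epsilon(w_a-w_d)}{w_a-w_b+w_c-w_d}.$ The Ptolemy coordinate of the oriented edge from $v_x$ to $v_y$ is $\det(V_x,V_y)$.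 For a vertex of $\overline o_i$ lying near $v_x$ on the edge $v_xv_y$ let $C_{xy}\in\mathrm{SL}(2,\mathbb C)$ have columns $V_x$ and $V_y/\det(V_x,V_y)$. Then $\mathcal B_i(e)=C_{xy}^{-1}C_{x'y'}$ for an edge $e$ from the vertex indexed $xy$ to that indexed $x'y'$. Changing the choice of square root or the sign of $q_i$ does not change $\mathcal B_i$ in $\mathrm{PSL}(2,\mathbb C)$. *)

theory Defs
  imports "HOL-Analysis.Determinants" "HOL-Algebra.Coset"
begin

text \<open>
  The four segment ends at a crossing, in counterclockwise order, starting from the incoming
  under-segment.
\<close>

datatype side = SA | SB | SC | SD

fun ccw :: "side \<Rightarrow> side" where
  "ccw SA = SB" | "ccw SB = SC" | "ccw SC = SD" | "ccw SD = SA"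

fun cw :: "side \<Rightarrow> side" where
  "cw SA = SD" | "cw SB = SA" | "cw SC = SB" | "cw SD = SC"

definition over :: "side \<Rightarrow> bool" where
  "over s \<longleftrightarrow> s = SB \<or> s = SD"

text \<open>
  The pair \<open>(i, s)\<close> stands for the end \<open>s\<close> of a segment at crossing \<open>i\<close>.  The same pairs index the
  corners: the corner \<open>(i, s)\<close> is the one between \<open>s\<close> and \<open>ccw s\<close>.
\<close>

type_synonym dart = "nat \<times> side"
type_synonym corner = "nat \<times> side"

text \<open>
  A diagram is a 4-valent graph on the 2-sphere, encoded as a combinatorial map with vertices
  \<open>0, \<dots>, n - 1\<close>: the map \<open>opp\<close> sends a segment end to the other end of the same segment.
\<close>

record diagram =
  crossings :: nat
  positive :: "nat \<Rightarrow> bool"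
  opp :: "dart \<Rightarrow> dart"

definition darts :: "diagram \<Rightarrow> dart set" where
  "darts D = {..<crossings D} \<times> UNIV"

text \<open>
  The under-strand runs from \<open>SA\<close> to \<open>SC\<close>; the over-strand runs from \<open>SD\<close> to \<open>SB\<close> at a positive
  crossing and from \<open>SB\<close> to \<open>SD\<close> at a negative one.
\<close>

definition outgoing :: "diagram \<Rightarrow> dart \<Rightarrow> bool" where
  "outgoing D = (\<lambda>(i, s). s = SC \<or> s = (if positive D i then SB else SD))"

definition across :: "dart \<Rightarrow> dart" where
  "across = (\<lambda>(i, s). (i, ccw (ccw s)))"

text \<open>
  The region to the left of a segment, seen from its end \<open>d = (i, s)\<close> outwards, has the corner
  \<open>(i, s)\<close> at this end; at the other end \<open>(j, t) = opp d\<close> it has the corner \<open>(j, cw t)\<close>.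
\<close>

definition next_corner :: "diagram \<Rightarrow> corner \<Rightarrow> corner" where
  "next_corner D d = (case opp D d of (j, t) \<Rightarrow> (j, cw t))"

definition region_rel :: "diagram \<Rightarrow> (corner \<times> corner) set" where
  "region_rel D = {(k, k'). k \<in> darts D \<and> k' \<in> darts D \<and>
     equivclp (\<lambda>x y. x \<in> darts D \<and> y = next_corner D x) k k'}"

text \<open>A region is represented by the set of its corners.\<close>

definition regions :: "diagram \<Rightarrow> corner set set" where
  "regions D = darts D // region_rel D"

definition region_of :: "diagram \<Rightarrow> corner \<Rightarrow> corner set" where
  "region_of D k = region_rel D `` {k}"

text \<open>
  The third condition says that there is a single link component (so that the graph is connected),
  and the last one is Euler's formula \<open>n - 2n + F = 2\<close>, that is, planarity.  It excludes the
  diagram without crossings, which has no octahedral decomposition.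
\<close>

definition knot_diagram :: "diagram \<Rightarrow> bool" where
  "knot_diagram D \<longleftrightarrow>
     (\<forall>d\<in>darts D. opp D d \<in> darts D \<and> opp D (opp D d) = d) \<and>
     (\<forall>d\<in>darts D. outgoing D (opp D d) \<longleftrightarrow> \<not> outgoing D d) \<and>
     (\<forall>d\<in>darts D. \<forall>d'\<in>darts D.
        equivclp (\<lambda>x y. x \<in> darts D \<and> (y = opp D x \<or> y = across x)) d d') \<and>
     card (regions D) = crossings D + 2"


definition corner_var :: "diagram \<Rightarrow> (corner set \<Rightarrow> complex) \<Rightarrow> nat \<Rightarrow> side \<Rightarrow> complex" where
  "corner_var D w i s = w (region_of D (i, s))"

text \<open>The two regions at the segment end \<open>(i, s)\<close> are those of the corners \<open>(i, s)\<close> and \<open>(i, cw s)\<close>.\<close>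

definition region_variables :: "diagram \<Rightarrow> (corner set \<Rightarrow> complex) \<Rightarrow> bool" where
  "region_variables D w \<longleftrightarrow>
     (\<forall>R\<in>regions D. w R \<noteq> 0) \<and>
     (\<forall>(i, s)\<in>darts D. corner_var D w i s \<noteq> corner_var D w i (cw s)) \<and>
     (\<forall>i<crossings D. corner_var D w i SA * corner_var D w i SC
        \<noteq> corner_var D w i SB * corner_var D w i SD)"

definition corner_f :: "diagram \<Rightarrow> (corner set \<Rightarrow> complex) \<Rightarrow> corner \<Rightarrow> complex" where
  "corner_f D w = (\<lambda>(i, s).
     let v = corner_var D w i s; v' = corner_var D w i (ccw s);
         v'' = corner_var D w i (cw s); vo = corner_var D w i (ccw (ccw s))
     in (v' - v) * (v'' - v) / (v' * v'' - v * vo))"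

definition corner_tau :: "diagram \<Rightarrow> (corner set \<Rightarrow> complex) \<Rightarrow> corner \<Rightarrow> complex" where
  "corner_tau D w = (\<lambda>(i, s).
     if over s then corner_f D w (i, s) else inverse (corner_f D w (i, s)))"

definition gluing_equations_T5 :: "diagram \<Rightarrow> (corner set \<Rightarrow> complex) \<Rightarrow> bool" where
  "gluing_equations_T5 D w \<longleftrightarrow> (\<forall>R\<in>regions D. (\<Prod>k\<in>R. corner_tau D w k) = 1)"

definition eta :: "diagram \<Rightarrow> (corner set \<Rightarrow> complex) \<Rightarrow> nat \<Rightarrow> complex" where
  "eta D w i =
     (if positive D i
      then corner_var D w i SB * corner_var D w i SD - corner_var D w i SA * corner_var D w i SC
      else corner_var D w i SA * corner_var D w i SC - corner_var D w i SB * corner_var D w i SD)"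

definition eq_up_to_sign :: "complex \<Rightarrow> complex \<Rightarrow> bool" where
  "eq_up_to_sign x y \<longleftrightarrow> x = y \<or> x = - y"

text \<open>
  Here \<open>r i\<close> is a square root of \<open>eta D w i\<close> and \<open>q i\<close> a representative of a class modulo sign.
  The quantification over all ends \<open>(i, s)\<close> means that every segment is drawn from left to right
  in both ways.
\<close>

definition q_relations ::
  "diagram \<Rightarrow> (corner set \<Rightarrow> complex) \<Rightarrow> (nat \<Rightarrow> complex) \<Rightarrow> (nat \<Rightarrow> complex) \<Rightarrow> bool" where
  "q_relations D w r q \<longleftrightarrow>
     (\<forall>(i, s)\<in>darts D. case opp D (i, s) of (j, t) \<Rightarrow>
        let wC = corner_var D w i s; wD = corner_var D w i (cw s) in
        eq_up_to_sign (q i / q j)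
          (if over s \<and> \<not> over t then (wC - wD) / r j
           else if \<not> over s \<and> over t then r i / (wC - wD)
           else if over s \<and> over t then 1
           else r i / r j))"


text \<open>\<open>VInf\<close> lies on the over-strand (top), \<open>VZero\<close> on the under-strand (bottom).\<close>

datatype vert = VInf | VZero | VSide side

definition tetrahedra :: "vert set set" where
  "tetrahedra =
     {{VInf, VSide SA, VSide SB, VSide SC}, {VInf, VSide SA, VSide SC, VSide SD},
      {VZero, VSide SB, VSide SC, VSide SD}, {VZero, VSide SA, VSide SB, VSide SD},
      {VSide SA, VSide SB, VSide SC, VSide SD}}"

text \<open>
  \<open>(x, y)\<close> stands for the vertex of a truncated octahedron that lies near \<open>x\<close> on the edge \<open>xy\<close>,
  and \<open>(i, u, v)\<close> for the oriented edge from \<open>u\<close> to \<open>v\<close> in the \<open>i\<close>-th truncated octahedron.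
\<close>

type_synonym tvert = "vert \<times> vert"
type_synonym oedge = "nat \<times> tvert \<times> tvert"

text \<open>
  Oriented edges, their reversal, and the boundary cycles of the two-dimensional faces of a union
  of truncated tetrahedra.
\<close>

record 'e truncated_complex =
  short_edges :: "'e set"
  long_edges :: "'e set"
  edge_rev :: "'e \<Rightarrow> 'e"
  face_cycles :: "'e list set"

definition octahedra :: "diagram \<Rightarrow> oedge truncated_complex" where
  "octahedra D =
     \<lparr>short_edges = {(i, (x, y), (x, z)) |i x y z.
        i < crossings D \<and> distinct [x, y, z] \<and> (\<exists>T\<in>tetrahedra. {x, y, z} \<subseteq> T)},
      long_edges = {(i, (x, y), (y, x)) |i x y.
        i < crossings D \<and> x \<noteq> y \<and> (\<exists>T\<in>tetrahedra. {x, y} \<subseteq> T)},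
      edge_rev = (\<lambda>(i, u, v). (i, v, u)),
      face_cycles =
        {[(i, (x, y), (x, z)), (i, (x, z), (x, t)), (i, (x, t), (x, y))] |i x y z t.
           i < crossings D \<and> distinct [x, y, z, t] \<and> {x, y, z, t} \<in> tetrahedra} \<union>
        {[(i, (x, y), (y, x)), (i, (y, x), (y, z)), (i, (y, z), (z, y)),
          (i, (z, y), (z, x)), (i, (z, x), (x, z)), (i, (x, z), (x, y))] |i x y z.
           i < crossings D \<and> distinct [x, y, z] \<and> (\<exists>T\<in>tetrahedra. {x, y, z} \<subseteq> T)}\<rparr>"

definition octa_edges :: "diagram \<Rightarrow> oedge set" where
  "octa_edges D = short_edges (octahedra D) \<union> long_edges (octahedra D)"

datatype vtype = AtKnot | AtP | AtQ

fun vert_type :: "vert \<Rightarrow> vtype" where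
  "vert_type VInf = AtKnot"
| "vert_type VZero = AtKnot"
| "vert_type (VSide s) = (if over s then AtQ else AtP)"

definition knot_vert :: "side \<Rightarrow> vert" where
  "knot_vert s = (if over s then VInf else VZero)"

text \<open>Left and right are as seen from the crossing when looking outwards along \<open>s\<close>.\<close>

definition left_face :: "side \<Rightarrow> vert set" where
  "left_face s = {knot_vert s, VSide s, VSide (ccw s)}"

definition right_face :: "side \<Rightarrow> vert set" where
  "right_face s = {knot_vert s, VSide s, VSide (cw s)}"

text \<open>
  The left side of a segment seen from one of its ends is the right side seen from the other end.
  As \<open>(i, s)\<close> ranges over both ends of a segment, both sides are covered.
\<close>

definition glued :: "diagram \<Rightarrow> oedge \<Rightarrow> oedge \<Rightarrow> bool" where
  "glued D e e' \<longleftrightarrow>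
     e \<in> octa_edges D \<and> e' \<in> octa_edges D \<and>
     (\<exists>i s j t x y z u x' y' z' u'.
        (i, s) \<in> darts D \<and> opp D (i, s) = (j, t) \<and>
        e = (i, (x, y), (z, u)) \<and> {x, y, z, u} \<subseteq> left_face s \<and>
        e' = (j, (x', y'), (z', u')) \<and> {x', y', z', u'} \<subseteq> right_face t \<and>
        map vert_type [x, y, z, u] = map vert_type [x', y', z', u'])"

definition identified :: "diagram \<Rightarrow> (oedge \<times> oedge) set" where
  "identified D = {(e, e'). e \<in> octa_edges D \<and> e' \<in> octa_edges D \<and> equivclp (glued D) e e'}"

definition edge_class :: "diagram \<Rightarrow> oedge \<Rightarrow> oedge set" where
  "edge_class D e = identified D `` {e}"

text \<open>
  The exterior of the knot with two open balls removed, decomposed into the truncated tetrahedra: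
  the quotient of the truncated octahedra by the gluing.
\<close>

definition exterior :: "diagram \<Rightarrow> oedge set truncated_complex" where
  "exterior D =
     \<lparr>short_edges = edge_class D ` short_edges (octahedra D),
      long_edges = edge_class D ` long_edges (octahedra D),
      edge_rev = (\<lambda>E. edge_rev (octahedra D) ` E),
      face_cycles = map (edge_class D) ` face_cycles (octahedra D)\<rparr>"


definition SL2 :: "(complex^2^2) monoid" where
  "SL2 = \<lparr>carrier = {A. det A = 1}, mult = (**), one = mat 1\<rparr>"

definition PSL2 :: "(complex^2^2) set monoid" where
  "PSL2 = SL2 Mod {mat 1, - mat 1}"

definition to_PSL2 :: "complex^2^2 \<Rightarrow> (complex^2^2) set" where
  "to_PSL2 A = {mat 1, - mat 1} #>\<^bsub>SL2\<^esub> A"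

definition unipotent :: "(complex^2^2) set" where
  "unipotent = {A. A$1$1 = 1 \<and> A$2$1 = 0 \<and> A$2$2 = 1}"

definition counter_diagonal :: "(complex^2^2) set" where
  "counter_diagonal = {A \<in> carrier SL2. A$1$1 = 0 \<and> A$2$2 = 0}"

text \<open>
  The group \<open>G\<close> is \<open>SL2\<close> with \<open>\<pi> = id\<close>, or \<open>PSL2\<close> with the projection \<open>\<pi> = to_PSL2\<close>.
\<close>

definition natural_cocycle ::
  "('g, 'm) monoid_scheme \<Rightarrow> (complex^2^2 \<Rightarrow> 'g) \<Rightarrow> 'e truncated_complex \<Rightarrow> ('e \<Rightarrow> 'g) \<Rightarrow> bool" where
  "natural_cocycle G \<pi> X \<B> \<longleftrightarrow>
     (\<forall>e \<in> short_edges X \<union> long_edges X. \<B> e \<in> carrier G) \<and>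
     (\<forall>e \<in> short_edges X \<union> long_edges X. \<B> e \<otimes>\<^bsub>G\<^esub> \<B> (edge_rev X e) = \<one>\<^bsub>G\<^esub>) \<and>
     (\<forall>es \<in> face_cycles X. foldr (\<otimes>\<^bsub>G\<^esub>) (map \<B> es) \<one>\<^bsub>G\<^esub> = \<one>\<^bsub>G\<^esub>) \<and>
     (\<forall>e \<in> short_edges X. \<B> e \<in> \<pi> ` unipotent) \<and>
     (\<forall>e \<in> long_edges X. \<B> e \<in> \<pi> ` counter_diagonal)"


definition columns2 :: "complex^2 \<Rightarrow> complex^2 \<Rightarrow> complex^2^2" where
  "columns2 u v = transpose (vector [u, v])"

context
  fixes D :: diagram and w :: "corner set \<Rightarrow> complex" and r q :: "nat \<Rightarrow> complex"
begin

fun octa_vec :: "nat \<Rightarrow> vert \<Rightarrow> complex^2" where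
  "octa_vec i VInf = vector [1, 0]"
| "octa_vec i VZero =
     (let \<epsilon> = (if positive D i then 1 else - 1); W = corner_var D w i in
      (1 / r i) *s vector [\<epsilon> * (W SA - W SD), W SA - W SB + W SC - W SD])"
| "octa_vec i (VSide SA) = q i *s vector [0, 1]"
| "octa_vec i (VSide SC) = q i *s vector [if positive D i then 1 else - 1, 1]"
| "octa_vec i (VSide SB) =
     (let \<epsilon> = (if positive D i then 1 else - 1); W = corner_var D w i in
      (1 / q i) *s vector [\<epsilon> * W SA, W SA - W SB])"
| "octa_vec i (VSide SD) =
     (let \<epsilon> = (if positive D i then 1 else - 1); W = corner_var D w i in
      (1 / q i) *s vector [\<epsilon> * W SD, W SD - W SC])"

definition ptolemy :: "nat \<Rightarrow> vert \<Rightarrow> vert \<Rightarrow> complex" where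
  "ptolemy i x y = det (columns2 (octa_vec i x) (octa_vec i y))"

definition octa_mat :: "nat \<Rightarrow> tvert \<Rightarrow> complex^2^2" where
  "octa_mat i = (\<lambda>(x, y). columns2 (octa_vec i x) ((1 / ptolemy i x y) *s octa_vec i y))"

text \<open>On the edges of the \<open>i\<close>-th truncated octahedron this is \<open>\<B>\<^sub>i\<close>.\<close>

definition octa_cocycle :: "oedge \<Rightarrow> complex^2^2" where
  "octa_cocycle = (\<lambda>(i, u, v). matrix_inv (octa_mat i u) ** octa_mat i v)"

end

end

theory Submission
  imports Defs
begin

text \<open>
  On a long edge \<open>xy\<close> the cocycle of an octahedron is determined by the Ptolemy coordinate
  \<open>p\<^sub>x\<^sub>y\<close>, and on the short edge at \<open>x\<close> in a face \<open>xyz\<close> by the ratio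
  \<open>- p\<^sub>y\<^sub>z / (p\<^sub>x\<^sub>y p\<^sub>x\<^sub>z) = p\<^sub>x\<^sub>y p\<^sub>y\<^sub>z p\<^sub>z\<^sub>x / (p\<^sub>x\<^sub>y p\<^sub>x\<^sub>z)\<^sup>2\<close>.
  In \<open>PSL\<close> it therefore suffices that across glued faces the squares of the Ptolemy coordinates
  agree, and that the product of the three coordinates around a face agrees exactly.  The former
  is the content of the \<open>q\<close>-relations.  The latter holds because \<open>q\<close> and the square root of
  \<open>\<eta>\<close> cancel in the product: with \<open>L\<close> and \<open>R\<close> the variables to the left and right of the
  segment, seen from the crossing outwards, the product over the left face is \<open>L (R - L)\<close> for an
  outgoing and \<open>L (L - R)\<close> for an incoming segment, and passing to the other end of the segment
  exchanges both \<open>L\<close> with \<open>R\<close> and outgoing with incoming.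
\<close>

section \<open>The groups\<close>

lemma det_columns2: "det (columns2 u v) = u$1 * v$2 - u$2 * v$1"
  by (simp add: det_2 columns2_def transpose_def)

lemma matrix_inv_right:
  assumes "det (A :: complex^'n^'n) \<noteq> 0"
  shows "A ** matrix_inv A = mat 1"
proof -
  have "\<exists>B. A ** B = mat 1 \<and> B ** A = mat 1"
    using assms by (simp add: invertible_det_nz[symmetric] invertible_def)
  then show ?thesis
    unfolding matrix_inv_def by (rule someI2_ex) simp
qed

lemma matrix_inv_left:
  assumes "det (A :: complex^'n^'n) \<noteq> 0"
  shows "matrix_inv A ** A = mat 1"
  using assms matrix_inv_right matrix_left_right_inverse by blast

lemma det_matrix_inv_1:
  assumes "det (A :: complex^'n^'n) = 1"
  shows "det (matrix_inv A) = 1"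
proof -
  have "det (matrix_inv A) * det A = 1"
    unfolding det_mul[symmetric] using assms by (simp add: matrix_inv_left)
  with assms show ?thesis by simp
qed

text \<open>Lets a value of the cocycle be verified by multiplying columns, without computing an
  inverse.\<close>

lemma matrix_inv_mult_eqI:
  fixes A :: "complex^'n^'n"
  assumes "det A \<noteq> 0" "B = A ** C"
  shows "matrix_inv A ** B = C"
  using assms by (simp add: matrix_mul_assoc matrix_inv_left)

lemma uminus_matrix_mult: "(- A) ** B = - (A ** B)" "A ** (- B) = - (A ** B)"
  for A B :: "complex^'n^'n"
  by (simp_all add: vec_eq_iff matrix_matrix_mult_def sum_negf)

lemma det_uminus_2: "det (- A) = det A" for A :: "complex^2^2"
  by (simp add: det_2)

lemma group_SL2: "group SL2"
proof (rule groupI)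
  fix A assume "A \<in> carrier SL2"
  then show "\<exists>B\<in>carrier SL2. B \<otimes>\<^bsub>SL2\<^esub> A = \<one>\<^bsub>SL2\<^esub>"
    by (intro bexI[of _ "matrix_inv A"]) (simp_all add: SL2_def matrix_inv_left det_matrix_inv_1)
qed (auto simp: SL2_def det_mul matrix_mul_assoc)

text \<open>Both elements are central, so left and right cosets coincide.\<close>

lemma center_normal_SL2: "{mat 1, - mat 1} \<lhd> SL2"
proof -
  interpret group SL2 by (rule group_SL2)
  have "inv\<^bsub>SL2\<^esub> (- mat 1) = - mat 1"
    by (rule inv_equality) (simp_all add: SL2_def det_uminus_2 uminus_matrix_mult)
  moreover have "inv\<^bsub>SL2\<^esub> (mat 1) = mat 1"
    by (rule inv_equality) (simp_all add: SL2_def)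
  ultimately have "subgroup {mat 1, - mat 1} SL2"
    by (intro subgroupI) (auto simp: SL2_def det_uminus_2 uminus_matrix_mult)
  then show ?thesis
    by (rule normalI) (auto simp: SL2_def r_coset_def l_coset_def uminus_matrix_mult)
qed

lemma to_PSL2_hom: "to_PSL2 \<in> hom SL2 PSL2"
  using normal.r_coset_hom_Mod[OF center_normal_SL2]
  by (simp add: to_PSL2_def[abs_def] PSL2_def)

lemma group_PSL2: "group PSL2"
  using normal.factorgroup_is_group[OF center_normal_SL2] by (simp add: PSL2_def)

lemma to_PSL2_one: "to_PSL2 (mat 1) = \<one>\<^bsub>PSL2\<^esub>"
  using hom_one[OF to_PSL2_hom group_SL2 group_PSL2] by (simp add: SL2_def)

lemma to_PSL2_uminus: "to_PSL2 (- A) = to_PSL2 A"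
  by (auto simp: to_PSL2_def r_coset_def SL2_def uminus_matrix_mult)

lemma to_PSL2_mult:
  assumes "det A = 1" "det B = 1"
  shows "to_PSL2 A \<otimes>\<^bsub>PSL2\<^esub> to_PSL2 B = to_PSL2 (A ** B)"
  using hom_mult[OF to_PSL2_hom, of A B] assms by (simp add: SL2_def)

lemma to_PSL2_carrier: "det A = 1 \<Longrightarrow> to_PSL2 A \<in> carrier PSL2"
  using hom_in_carrier[OF to_PSL2_hom, of A] by (simp add: SL2_def)

lemma det_foldr:
  assumes "\<And>A. A \<in> set As \<Longrightarrow> det A = 1"
  shows "det (foldr (**) As (mat 1 :: complex^2^2)) = 1"
  using assms by (induction As) (auto simp: det_mul)

lemma to_PSL2_foldr:
  assumes "\<And>A. A \<in> set As \<Longrightarrow> det A = 1"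
  shows "foldr (\<otimes>\<^bsub>PSL2\<^esub>) (map to_PSL2 As) \<one>\<^bsub>PSL2\<^esub> = to_PSL2 (foldr (**) As (mat 1))"
  using assms by (induction As) (simp_all add: to_PSL2_one to_PSL2_mult det_foldr)

text \<open>Normal forms of the cocycle on short and long edges: each value depends on a single
  complex parameter.\<close>

definition short_mat :: "complex \<Rightarrow> complex^2^2" where
  "short_mat c = vector [vector [1, c], vector [0, 1]]"

definition long_mat :: "complex \<Rightarrow> complex^2^2" where
  "long_mat p = vector [vector [0, - 1 / p], vector [p, 0]]"

lemma short_mat_unipotent: "short_mat c \<in> unipotent"
  by (simp add: short_mat_def unipotent_def)

lemma long_mat_counter_diagonal: "p \<noteq> 0 \<Longrightarrow> long_mat p \<in> counter_diagonal"
  by (simp add: long_mat_def counter_diagonal_def SL2_def det_2)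

text \<open>Equal squares leave only \<open>p = p'\<close> or \<open>p = - p'\<close>, and negating
  \<open>p\<close> negates the matrix. For \<open>short_mat\<close> a sign change of the parameter
  is not absorbed in this way.\<close>

lemma to_PSL2_long_mat:
  assumes "p^2 = p'^2"
  shows "to_PSL2 (long_mat p) = to_PSL2 (long_mat p')"
proof -
  have "long_mat (- p') = - long_mat p'"
    by (simp add: long_mat_def vec_eq_iff forall_2)
  then show ?thesis
    using assms to_PSL2_uminus by (auto simp: power2_eq_iff)
qed

section \<open>The cocycle in terms of Ptolemy coordinates\<close>

locale octa_data =
  fixes D :: diagram and w :: "corner set \<Rightarrow> complex" and r q :: "nat \<Rightarrow> complex"
begin

abbreviation pt where "pt \<equiv> ptolemy D w r q"
abbreviation vc where "vc \<equiv> octa_vec D w r q"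
abbreviation oc where "oc \<equiv> octa_cocycle D w r q"

lemma ptolemy_eq: "pt i x y = vc i x $ 1 * vc i y $ 2 - vc i x $ 2 * vc i y $ 1"
  by (simp add: ptolemy_def det_columns2)

lemma ptolemy_swap: "pt i x y = - pt i y x"
  by (simp add: ptolemy_eq)

lemma ptolemy_nonzero_swap: "pt i x y \<noteq> 0 \<Longrightarrow> pt i y x \<noteq> 0"
  using ptolemy_swap[of i x y] by simp

lemma det_octa_mat:
  assumes "pt i x y \<noteq> 0"
  shows "det (octa_mat D w r q i (x, y)) = 1"
proof -
  have "det (octa_mat D w r q i (x, y)) =
      (vc i x $ 1 * vc i y $ 2 - vc i x $ 2 * vc i y $ 1) / pt i x y"
    by (simp add: octa_mat_def det_columns2 diff_divide_distrib)
  with assms show ?thesis by (simp add: ptolemy_eq)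
qed

text \<open>Three vectors in the plane satisfy det(x,y) z + det(y,z) x + det(z,x) y = 0. Dividing by
  the product of the two coordinates at \<open>x\<close> writes the normalised \<open>z\<close> as
  the normalised \<open>y\<close> plus a multiple of \<open>x\<close>.\<close>

lemma octa_cocycle_short:
  assumes "pt i x y \<noteq> 0" "pt i x z \<noteq> 0"
  shows "oc (i, (x, y), (x, z)) = short_mat (- pt i y z / (pt i x y * pt i x z))"
  unfolding octa_cocycle_def prod.case
proof (rule matrix_inv_mult_eqI)
  show "octa_mat D w r q i (x, z) =
    octa_mat D w r q i (x, y) ** short_mat (- pt i y z / (pt i x y * pt i x z))"
  proof -
    have "vc i z $ k / pt i x z = vc i x $ k * (- pt i y z / (pt i x y * pt i x z)) + vc i y $ k / pt i x y"
      if "k = 1 \<or> k = 2" for k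
      using that assms by (auto simp: field_simps) (auto simp: ptolemy_eq algebra_simps)
    then show ?thesis
      by (simp add: octa_mat_def columns2_def transpose_def short_mat_def vec_eq_iff forall_2
          matrix_matrix_mult_def sum_2)
  qed
qed (use assms det_octa_mat in simp)

text \<open>The two matrices have the same columns up to order and scale; the minus sign comes from
  the antisymmetry of \<open>pt\<close>.\<close>

lemma octa_cocycle_long:
  assumes "pt i x y \<noteq> 0"
  shows "oc (i, (x, y), (y, x)) = long_mat (pt i x y)"
  unfolding octa_cocycle_def prod.case
proof (rule matrix_inv_mult_eqI)
  show "octa_mat D w r q i (y, x) = octa_mat D w r q i (x, y) ** long_mat (pt i x y)"
    using assms ptolemy_swap[of i y x]
    by (simp add: octa_mat_def columns2_def transpose_def long_mat_def vec_eq_iff forall_2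
        matrix_matrix_mult_def sum_2)
qed (use assms det_octa_mat in simp)

end

section \<open>Gluing of faces\<close>

text \<open>The vertex of a given type in the face at \<open>s\<close> on the side of the neighbour \<open>n\<close>.\<close>

fun face_vert :: "side \<Rightarrow> side \<Rightarrow> vtype \<Rightarrow> vert" where
  "face_vert s n AtKnot = knot_vert s"
| "face_vert s n AtP = VSide (if over s then n else s)"
| "face_vert s n AtQ = VSide (if over s then s else n)"

text \<open>A face has one vertex of each type, so gluing by matching types amounts to using types
  as common names for the vertices of both faces.\<close>

lemma left_face_vert: "x \<in> left_face s \<Longrightarrow> x = face_vert s (ccw s) (vert_type x)"
  by (cases s) (auto simp: left_face_def knot_vert_def over_def)

lemma right_face_vert: "x \<in> right_face s \<Longrightarrow> x = face_vert s (cw s) (vert_type x)"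
  by (cases s) (auto simp: right_face_def knot_vert_def over_def)

locale glued_ptolemy = octa_data +
  assumes opp_dart: "d \<in> darts D \<Longrightarrow> opp D d \<in> darts D"
    and opp_opp: "d \<in> darts D \<Longrightarrow> opp D (opp D d) = d"
    and outgoing_opp: "d \<in> darts D \<Longrightarrow> outgoing D (opp D d) \<longleftrightarrow> \<not> outgoing D d"
    and region_variables: "region_variables D w"
    and r_squared: "i < crossings D \<Longrightarrow> (r i)^2 = eta D w i"
    and q_nonzero: "i < crossings D \<Longrightarrow> q i \<noteq> 0"
    and q_relations: "q_relations D w r q"
begin

abbreviation W where "W \<equiv> corner_var D w"

abbreviation sgn_of :: "nat \<Rightarrow> complex" where
  "sgn_of i \<equiv> if positive D i then 1 else - 1"

section \<open>Ptolemy coordinates of a single octahedron\<close>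

lemma corner_var_nonzero: "i < crossings D \<Longrightarrow> W i s \<noteq> 0"
  using region_variables
  by (auto simp: region_variables_def corner_var_def region_of_def regions_def darts_def
      intro!: quotientI)

lemma corner_var_adjacent: "i < crossings D \<Longrightarrow> W i s \<noteq> W i (cw s)"
  using region_variables by (auto simp: region_variables_def darts_def)

lemma r_nonzero: "i < crossings D \<Longrightarrow> r i \<noteq> 0"
  using region_variables r_squared[of i]
  by (auto simp: region_variables_def eta_def split: if_splits)

lemma ptolemy_VInf:
  "pt i VInf (VSide SA) = q i" "pt i VInf (VSide SC) = q i"
  "pt i VInf (VSide SB) = (W i SA - W i SB) / q i"
  "pt i VInf (VSide SD) = (W i SD - W i SC) / q i"
  by (simp_all add: ptolemy_eq Let_def)

lemma ptolemy_VZero: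
  assumes "i < crossings D"
  shows "pt i VZero (VSide SA) = sgn_of i * (W i SA - W i SD) * q i / r i"
    and "pt i VZero (VSide SC) = sgn_of i * (W i SB - W i SC) * q i / r i"
    and "pt i VZero (VSide SB) = r i / q i"
    and "pt i VZero (VSide SD) = r i / q i"
proof -
  note nz = r_nonzero[OF assms] q_nonzero[OF assms]
  have eta: "r i * r i = sgn_of i * (W i SB * W i SD - W i SA * W i SC)"
    using r_squared[OF assms] by (simp add: eta_def power2_eq_square)
  show "pt i VZero (VSide SA) = sgn_of i * (W i SA - W i SD) * q i / r i"
    "pt i VZero (VSide SC) = sgn_of i * (W i SB - W i SC) * q i / r i"
    using nz by (simp_all add: ptolemy_eq Let_def field_simps)
  \<comment> \<open>Both determinants expand to the same numerator, which is \<open>eta\<close>; one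
    factor \<open>r i\<close> then cancels.\<close>
  have "pt i VZero (VSide SB) = sgn_of i * (W i SB * W i SD - W i SA * W i SC) / (r i * q i)"
    "pt i VZero (VSide SD) = sgn_of i * (W i SB * W i SD - W i SA * W i SC) / (r i * q i)"
    using nz by (simp_all add: ptolemy_eq Let_def field_simps)
  then show "pt i VZero (VSide SB) = r i / q i" "pt i VZero (VSide SD) = r i / q i"
    using nz unfolding eta[symmetric] by simp_all
qed

text \<open>The first four edges run from \<open>AtP\<close> to \<open>AtQ\<close>, which gives them
  a common sign; up to it each carries the variable of the corner it spans. The last two are the
  diagonals introduced by the subdivision.\<close>

lemma ptolemy_sides:
  assumes "i < crossings D"
  shows "pt i (VSide SA) (VSide SB) = - sgn_of i * W i SA"
    and "pt i (VSide SC) (VSide SB) = - sgn_of i * W i SB"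
    and "pt i (VSide SC) (VSide SD) = - sgn_of i * W i SC"
    and "pt i (VSide SA) (VSide SD) = - sgn_of i * W i SD"
    and "pt i (VSide SA) (VSide SC) = - sgn_of i * (q i)^2"
    and "pt i (VSide SB) (VSide SD) = (r i)^2 / (q i)^2"
  using q_nonzero[OF assms] r_squared[OF assms]
  by (simp_all add: ptolemy_eq Let_def eta_def power2_eq_square field_simps)

text \<open>The only two distinct vertices in no common tetrahedron are \<open>VInf\<close> and
  \<open>VZero\<close>. All other coordinates are, up to sign, products and quotients of
  \<open>q i\<close>, \<open>r i\<close>, corner variables and differences of neighbouring
  ones.\<close>

lemma ptolemy_nonzero:
  assumes "i < crossings D" "x \<noteq> y" "T \<in> tetrahedra" "{x, y} \<subseteq> T"
  shows "pt i x y \<noteq> 0"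
proof -
  have "x = VInf \<and> (\<exists>s. y = VSide s) \<or> x = VZero \<and> (\<exists>s. y = VSide s) \<or>
    y = VInf \<and> (\<exists>s. x = VSide s) \<or> y = VZero \<and> (\<exists>s. x = VSide s) \<or>
    (\<exists>s t. x = VSide s \<and> y = VSide t \<and> s \<noteq> t)"
    using assms(2-) by (auto simp: tetrahedra_def)
  moreover have "pt i (VSide s) (VSide t) \<noteq> 0" if "s \<noteq> t" for s t
  proof -
    have six: "pt i (VSide SA) (VSide SB) \<noteq> 0" "pt i (VSide SC) (VSide SB) \<noteq> 0"
      "pt i (VSide SC) (VSide SD) \<noteq> 0" "pt i (VSide SA) (VSide SD) \<noteq> 0"
      "pt i (VSide SA) (VSide SC) \<noteq> 0" "pt i (VSide SB) (VSide SD) \<noteq> 0"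
      unfolding ptolemy_sides[OF assms(1)]
      using q_nonzero[OF assms(1)] r_nonzero[OF assms(1)] corner_var_nonzero[OF assms(1)]
      by simp_all
    show ?thesis
      using that six six[THEN ptolemy_nonzero_swap] by (cases s; cases t; simp)
  qed
  moreover have "pt i VInf (VSide s) \<noteq> 0" "pt i VZero (VSide s) \<noteq> 0" for s
    using ptolemy_VInf[of i] ptolemy_VZero[OF assms(1)] q_nonzero[OF assms(1)]
      r_nonzero[OF assms(1)] corner_var_adjacent[OF assms(1), of SA]
      corner_var_adjacent[OF assms(1), of SB] corner_var_adjacent[OF assms(1), of SC]
      corner_var_adjacent[OF assms(1), of SD]
    by (cases s; simp)+
  ultimately show ?thesis
    using ptolemy_nonzero_swap by metis
qed

text \<open>The neighbour \<open>n\<close> does not affect the value: \<open>VSide SA\<close> and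
  \<open>VSide SC\<close> have the same coordinate \<open>q i\<close> with \<open>VInf\<close>. For
  \<open>AtQ\<close> the analogous common value is \<open>r i / q i\<close>, of
  \<open>VSide SB\<close> and \<open>VSide SD\<close> with \<open>VZero\<close>.\<close>

lemma ptolemy_knot_P:
  assumes "i < crossings D" "n = ccw s \<or> n = cw s"
  shows "(pt i (knot_vert s) (face_vert s n AtP))^2 =
    (if over s then (q i)^2 else ((W i s - W i (cw s)) * q i / r i)^2)"
  using assms(2) ptolemy_VInf[of i] ptolemy_VZero[OF assms(1)]
  by (cases s) (auto simp: knot_vert_def over_def power2_commute power_divide power_mult_distrib)

lemma ptolemy_knot_Q:
  assumes "i < crossings D" "n = ccw s \<or> n = cw s"
  shows "(pt i (knot_vert s) (face_vert s n AtQ))^2 =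
    (if over s then ((W i s - W i (cw s)) / q i)^2 else (r i / q i)^2)"
  using assms(2) ptolemy_VInf[of i] ptolemy_VZero[OF assms(1)]
  by (cases s) (auto simp: knot_vert_def over_def power2_commute power_divide power_mult_distrib)

lemma ptolemy_P_Q:
  assumes "i < crossings D"
  shows "(pt i (face_vert s (ccw s) AtP) (face_vert s (ccw s) AtQ))^2 = (W i s)^2"
    and "(pt i (face_vert s (cw s) AtP) (face_vert s (cw s) AtQ))^2 = (W i (cw s))^2"
  using ptolemy_sides[OF assms]
  by (cases s; simp add: over_def)+

section \<open>Signed products of coordinates around a face\<close>

definition face_prod :: "nat \<Rightarrow> vert \<Rightarrow> vert \<Rightarrow> vert \<Rightarrow> complex" where
  "face_prod i x y z = pt i x y * pt i y z * pt i z x"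

lemma face_prod_left:
  assumes "i < crossings D"
  shows "face_prod i (knot_vert s) (face_vert s (ccw s) AtP) (face_vert s (ccw s) AtQ) =
    W i s * (if outgoing D (i, s) then W i (cw s) - W i s else W i s - W i (cw s))"
  using q_nonzero[OF assms] r_nonzero[OF assms]
  by (cases s)
    (simp_all add: face_prod_def over_def knot_vert_def outgoing_def field_simps
      ptolemy_sides[OF assms] ptolemy_VInf ptolemy_VZero[OF assms]
      ptolemy_swap[of i _ VInf] ptolemy_swap[of i _ VZero])

text \<open>The two edges at the knot vertex contribute exactly as on the left face, signs included;
  only the edge between side vertices now spans the corner \<open>cw s\<close>.\<close>

lemma face_prod_right:
  assumes "i < crossings D"
  shows "face_prod i (knot_vert s) (face_vert s (cw s) AtP) (face_vert s (cw s) AtQ) =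
    W i (cw s) * (if outgoing D (i, s) then W i (cw s) - W i s else W i s - W i (cw s))"
  using q_nonzero[OF assms] r_nonzero[OF assms]
  by (cases s)
    (simp_all add: face_prod_def over_def knot_vert_def outgoing_def field_simps
      ptolemy_sides[OF assms] ptolemy_VInf ptolemy_VZero[OF assms]
      ptolemy_swap[of i _ VInf] ptolemy_swap[of i _ VZero])

text \<open>A step of \<open>next_corner\<close> stays inside one region, so both corners define the
  same class.\<close>

lemma corner_var_next:
  assumes "(i, s) \<in> darts D" "opp D (i, s) = (j, t)"
  shows "W j (cw t) = W i s"
proof -
  have mem: "next_corner D (i, s) \<in> darts D"
    using assms opp_dart[OF assms(1)] by (simp add: next_corner_def darts_def)
  then have "((i, s), next_corner D (i, s)) \<in> region_rel D"
    using assms by (auto simp: region_rel_def)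
  moreover have "equiv (darts D) (region_rel D)"
    by (auto simp: region_rel_def equiv_def refl_on_def sym_on_def trans_on_def
        intro: equivclp_sym equivclp_trans)
  ultimately have "region_of D (i, s) = region_of D (next_corner D (i, s))"
    unfolding region_of_def by (rule equiv_class_eq[rotated])
  then show ?thesis
    using assms by (simp add: corner_var_def next_corner_def)
qed

section \<open>Comparison of the two ends of one segment\<close>

context
  fixes i s j t
  assumes dart: "(i, s) \<in> darts D" and opp: "opp D (i, s) = (j, t)"
begin

lemma crossing_i: "i < crossings D" and crossing_j: "j < crossings D"
  using dart opp opp_dart[OF dart] by (auto simp: darts_def)

lemma corner_vars_glued: "W j (cw t) = W i s" "W i (cw s) = W j t"
  \<comment> \<open>The second equation is the first one for the segment traversed
    backwards.\<close>
  using corner_var_next[OF dart opp] corner_var_next[of j t i s] opp_dart[OF dart] opp_opp[OF dart]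
    opp by auto

lemma q_relation_squared:
  "(q i / q j)^2 =
    (if over s \<and> \<not> over t then (W i s - W i (cw s)) / r j
     else if \<not> over s \<and> over t then r i / (W i s - W i (cw s))
     else if over s \<and> over t then 1
     else r i / r j)^2"
proof -
  have "eq_up_to_sign x y \<Longrightarrow> x^2 = y^2" for x y
    by (auto simp: eq_up_to_sign_def)
  then show ?thesis
    using q_relations dart opp unfolding q_relations_def Let_def by fastforce
qed

text \<open>In each of the four over/under cases, both edges at the knot reduce to the squared
  \<open>q\<close>-relation. The edge between side vertices carries, up to sign, the variable of the
  common region at either end.\<close>

lemma ptolemy_glued:
  "(pt i (face_vert s (ccw s) a) (face_vert s (ccw s) b))^2 =
   (pt j (face_vert t (cw t) a) (face_vert t (cw t) b))^2"
proof -
  \<comment> \<open>The difference of variables across the segment; it changes sign when seen from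
    the other end.\<close>
  define X where "X = W i s - W j t"
  have X: "W i s - W i (cw s) = X" "W j t - W j (cw t) = - X"
    by (simp_all add: X_def corner_vars_glued)
  have nz: "q i \<noteq> 0" "q j \<noteq> 0" "r i \<noteq> 0" "r j \<noteq> 0" "X \<noteq> 0"
    using q_nonzero r_nonzero crossing_i crossing_j corner_var_adjacent[of i s] X
    by auto
  have KP: "(pt i (knot_vert s) (face_vert s (ccw s) AtP))^2 =
      (pt j (knot_vert t) (face_vert t (cw t) AtP))^2"
    unfolding ptolemy_knot_P[OF crossing_i, OF disjI1[OF refl]]
      ptolemy_knot_P[OF crossing_j, OF disjI2[OF refl]] X
    using q_relation_squared[unfolded X] nz
    by (cases "over s"; cases "over t") (simp_all add: field_simps)
  have KQ: "(pt i (knot_vert s) (face_vert s (ccw s) AtQ))^2 =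
      (pt j (knot_vert t) (face_vert t (cw t) AtQ))^2"
    unfolding ptolemy_knot_Q[OF crossing_i, OF disjI1[OF refl]]
      ptolemy_knot_Q[OF crossing_j, OF disjI2[OF refl]] X
    using q_relation_squared[unfolded X] nz
    by (cases "over s"; cases "over t") (simp_all add: field_simps)
  have PQ: "(pt i (face_vert s (ccw s) AtP) (face_vert s (ccw s) AtQ))^2 =
      (pt j (face_vert t (cw t) AtP) (face_vert t (cw t) AtQ))^2"
    unfolding ptolemy_P_Q(1)[OF crossing_i] ptolemy_P_Q(2)[OF crossing_j]
    by (simp add: corner_vars_glued)
  have sw: "(pt k x y)^2 = (pt k y x)^2" for k x y
    by (subst ptolemy_swap) simp
  have diag: "pt k x x = 0" for k x
    by (simp add: ptolemy_eq)
  show ?thesis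
    \<comment> \<open>For equal types both sides vanish, so no distinctness has to be
      assumed.\<close>
    by (cases a; cases b; (simp only: diag)?; use KP KQ PQ sw in \<open>simp only: face_vert.simps\<close>)
qed

text \<open>Rotating the arguments preserves the product and a transposition negates it, on both
  faces alike, so the order knot, P, Q suffices.\<close>

lemma face_prod_glued:
  assumes "distinct [a, b, c]"
  shows "face_prod i (face_vert s (ccw s) a) (face_vert s (ccw s) b) (face_vert s (ccw s) c) =
    face_prod j (face_vert t (cw t) a) (face_vert t (cw t) b) (face_vert t (cw t) c)"
proof -
  have rot: "face_prod k x y z = face_prod k y z x" for k x y z
    by (simp add: face_prod_def)
  have swap: "face_prod k x y z = - face_prod k x z y" for k x y z
    unfolding face_prod_def
    using ptolemy_swap[of k x y] ptolemy_swap[of k y z] ptolemy_swap[of k z x]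
    by simp
  have eq: "face_prod i (face_vert s (ccw s) AtKnot) (face_vert s (ccw s) AtP) (face_vert s (ccw s) AtQ) =
      face_prod j (face_vert t (cw t) AtKnot) (face_vert t (cw t) AtP) (face_vert t (cw t) AtQ)"
    using outgoing_opp[OF dart] face_prod_left[OF crossing_i, of s] face_prod_right[OF crossing_j, of t]
      corner_vars_glued opp by simp
  show ?thesis
    using assms eq
    by (cases a; cases b; cases c) (metis distinct_length_2_or_more rot swap)+
qed

end

section \<open>The cocycle on the exterior\<close>

lemma octa_edges_rev: "(i, u, v) \<in> octa_edges D \<Longrightarrow> (i, v, u) \<in> octa_edges D"
proof -
  assume "(i, u, v) \<in> octa_edges D"
  then show "(i, v, u) \<in> octa_edges D"
    unfolding octa_edges_def octahedra_def by (auto simp: insert_commute)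
qed

lemma octa_edge_cases:
  assumes "e \<in> octa_edges D"
  obtains i x y z where "e = (i, (x, y), (x, z))" "distinct [x, y, z]"
      "pt i x y \<noteq> 0" "pt i x z \<noteq> 0" "pt i y z \<noteq> 0"
  | i x y where "e = (i, (x, y), (y, x))" "x \<noteq> y" "pt i x y \<noteq> 0"
proof -
  consider i x y z T where "e = (i, (x, y), (x, z))" "i < crossings D" "distinct [x, y, z]"
      "T \<in> tetrahedra" "{x, y, z} \<subseteq> T"
    | i x y T where "e = (i, (x, y), (y, x))" "i < crossings D" "x \<noteq> y"
      "T \<in> tetrahedra" "{x, y} \<subseteq> T"
    using assms by (auto simp: octa_edges_def octahedra_def)
  then show thesis
  proof cases
    case (1 i x y z T)
    then show thesis
      by (intro that(1)[of i x y z] ptolemy_nonzero[of i _ _ T]) auto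
  next
    case (2 i x y T)
    then show thesis
      by (intro that(2)[of i x y] ptolemy_nonzero[of i _ _ T]) auto
  qed
qed

lemma octa_cocycle_short_prod:
  assumes "pt i x y \<noteq> 0" "pt i x z \<noteq> 0"
  shows "oc (i, (x, y), (x, z)) = short_mat (face_prod i x y z / ((pt i x y)^2 * (pt i x z)^2))"
  using assms octa_cocycle_short[OF assms] ptolemy_swap[of i z x]
  by (simp add: face_prod_def power2_eq_square)

lemma octa_cocycle_glued:
  assumes "glued D e e'"
  shows "to_PSL2 (oc e) = to_PSL2 (oc e')"
proof -
  obtain i s j t x y z u x' y' z' u' where dart: "(i, s) \<in> darts D" and opp: "opp D (i, s) = (j, t)"
    and e: "e = (i, (x, y), (z, u))" and face: "{x, y, z, u} \<subseteq> left_face s"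
    and e': "e' = (j, (x', y'), (z', u'))" and face': "{x', y', z', u'} \<subseteq> right_face t"
    and types: "map vert_type [x, y, z, u] = map vert_type [x', y', z', u']"
    and edge: "e \<in> octa_edges D"
    using assms unfolding glued_def by (elim conjE exE) (rule that)
  define L where "L = face_vert s (ccw s)"
  define R where "R = face_vert t (cw t)"
  define a b c d where types_def:
    "a = vert_type x" "b = vert_type y" "c = vert_type z" "d = vert_type u"
  have L: "x = L a" "y = L b" "z = L c" "u = L d"
    using face by (simp_all add: L_def types_def left_face_vert[symmetric])
  have R: "x' = R a" "y' = R b" "z' = R c" "u' = R d"
    using face' types by (simp_all add: R_def types_def right_face_vert[symmetric])
  have types_inv: "vert_type (L a) = a" "vert_type (L b) = b" "vert_type (L c) = c"
    "vert_type (L d) = d"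
    by (simp_all only: L[symmetric] types_def[symmetric])
  have sq: "(pt i (L a') (L b'))^2 = (pt j (R a') (R b'))^2" for a' b'
    unfolding L_def R_def by (rule ptolemy_glued[OF dart opp])
  then have nz: "pt i (L a') (L b') \<noteq> 0 \<Longrightarrow> pt j (R a') (R b') \<noteq> 0" for a' b'
    by (metis zero_eq_power2)
  from edge show ?thesis
  proof (cases rule: octa_edge_cases)
    case (1 k p1 p2 p3)
    then have k: "k = i" "p1 = L a" "p2 = L b" "p3 = L d" "L c = L a"
      using e L by auto
    \<comment> \<open>Equal vertices have equal types, so the glued edge \<open>e'\<close> is also a
      short edge, with vertices of the same types.\<close>
    have "c = a" using types_inv k(5) by simp
    have "distinct [a, b, d]" using 1(2) k by auto
    then have *: "face_prod i (L a) (L b) (L d) = face_prod j (R a) (R b) (R d)"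
      unfolding L_def R_def by (rule face_prod_glued[OF dart opp])
    have nz1: "pt i (L a) (L b) \<noteq> 0" "pt i (L a) (L d) \<noteq> 0"
      using 1(3,4) unfolding k .
    show ?thesis
      unfolding e e' L R \<open>c = a\<close> octa_cocycle_short_prod[OF nz1]
        octa_cocycle_short_prod[OF nz1[THEN nz]] * sq ..
  next
    case (2 k p1 p2)
    then have k: "k = i" "p1 = L a" "p2 = L b" "L c = L b" "L d = L a"
      using e L by auto
    have "c = b" "d = a" using types_inv k(4,5) by simp_all
    have nz2: "pt i (L a) (L b) \<noteq> 0"
      using 2(3) unfolding k .
    show ?thesis
      unfolding e e' L R \<open>c = b\<close> \<open>d = a\<close> octa_cocycle_long[OF nz2] octa_cocycle_long[OF nz2[THEN nz]]
      by (rule to_PSL2_long_mat) (rule sq)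
  qed
qed

lemma octa_cocycle_identified:
  assumes "(e, e') \<in> identified D"
  shows "to_PSL2 (oc e) = to_PSL2 (oc e')"
proof -
  have "equivclp (glued D) e e'"
    using assms by (simp add: identified_def)
  then show ?thesis
    by (induction rule: equivclp_induct) (auto dest: octa_cocycle_glued)
qed

text \<open>Inside one octahedron the cocycle is a coboundary: the matrix at \<open>v\<close>
  cancels its inverse. Products around faces therefore telescope.\<close>

lemma octa_cocycle_trans:
  assumes "det (octa_mat D w r q i v) = 1"
  shows "oc (i, u, v) ** oc (i, v, v') = oc (i, u, v')"
proof -
  have "oc (i, u, v) ** oc (i, v, v') = matrix_inv (octa_mat D w r q i u) **
      (octa_mat D w r q i v ** matrix_inv (octa_mat D w r q i v)) ** octa_mat D w r q i v'"
    by (simp add: octa_cocycle_def matrix_mul_assoc)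
  then show ?thesis
    using assms by (simp add: octa_cocycle_def matrix_inv_right)
qed

lemma octa_cocycle_refl:
  assumes "det (octa_mat D w r q i u) = 1"
  shows "oc (i, u, u) = mat 1"
  using assms by (simp add: octa_cocycle_def matrix_inv_left)

lemma det_octa_mat_edge:
  assumes "(i, u, v) \<in> octa_edges D"
  shows "det (octa_mat D w r q i u) = 1" "det (octa_mat D w r q i v) = 1"
proof -
  show "det (octa_mat D w r q i u) = 1"
    using assms by (cases rule: octa_edge_cases) (simp_all add: det_octa_mat)
  show "det (octa_mat D w r q i v) = 1"
    using assms by (cases rule: octa_edge_cases) (simp_all add: det_octa_mat ptolemy_nonzero_swap)
qed

lemma det_octa_cocycle:
  assumes "e \<in> octa_edges D"
  shows "det (oc e) = 1"
proof -
  obtain i u v where e: "e = (i, u, v)" by (cases e)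
  show ?thesis
    using det_octa_mat_edge[of i u v] assms
    by (simp add: e octa_cocycle_def det_mul det_matrix_inv_1)
qed

lemma octa_cocycle_short_edge:
  assumes "e \<in> short_edges (octahedra D)"
  shows "oc e \<in> unipotent"
proof -
  obtain i x y z T where "e = (i, (x, y), (x, z))" "i < crossings D" "distinct [x, y, z]"
      "T \<in> tetrahedra" "{x, y, z} \<subseteq> T"
    using assms by (auto simp: octahedra_def)
  then show ?thesis
    by (simp add: octa_cocycle_short ptolemy_nonzero short_mat_unipotent)
qed

lemma octa_cocycle_long_edge:
  assumes "e \<in> long_edges (octahedra D)"
  shows "oc e \<in> counter_diagonal"
proof -
  obtain i x y T where "e = (i, (x, y), (y, x))" "i < crossings D" "x \<noteq> y"
      "T \<in> tetrahedra" "{x, y} \<subseteq> T"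
    using assms by (auto simp: octahedra_def)
  then show ?thesis
    by (simp add: octa_cocycle_long ptolemy_nonzero long_mat_counter_diagonal)
qed

section \<open>Faces of the truncated octahedra\<close>

lemma short_edge_mem:
  assumes "i < crossings D" "distinct [x, y, z]" "T \<in> tetrahedra" "{x, y, z} \<subseteq> T"
  shows "(i, (x, y), (x, z)) \<in> octa_edges D"
  using assms unfolding octa_edges_def octahedra_def by auto

lemma long_edge_mem:
  assumes "i < crossings D" "x \<noteq> y" "T \<in> tetrahedra" "{x, y} \<subseteq> T"
  shows "(i, (x, y), (y, x)) \<in> octa_edges D"
  using assms unfolding octa_edges_def octahedra_def by auto

lemma face_cycle_cases:
  assumes "es \<in> face_cycles (octahedra D)"
  obtains i x y z t where "es = [(i, (x, y), (x, z)), (i, (x, z), (x, t)), (i, (x, t), (x, y))]"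
      "i < crossings D" "distinct [x, y, z, t]" "{x, y, z, t} \<in> tetrahedra"
  | i x y z T where "es = [(i, (x, y), (y, x)), (i, (y, x), (y, z)), (i, (y, z), (z, y)),
          (i, (z, y), (z, x)), (i, (z, x), (x, z)), (i, (x, z), (x, y))]"
      "i < crossings D" "distinct [x, y, z]" "T \<in> tetrahedra" "{x, y, z} \<subseteq> T"
proof -
  from assms show thesis
    unfolding octahedra_def truncated_complex.simps Un_iff mem_Collect_eq
  proof (elim disjE exE conjE bexE)
  qed (rule that, assumption+)+
qed

lemma face_cycle_edges:
  assumes "es \<in> face_cycles (octahedra D)"
  shows "set es \<subseteq> octa_edges D"
  using assms
proof (cases rule: face_cycle_cases)
  case (1 i x y z t)
  then show ?thesis
    by (auto intro!: short_edge_mem[where T = "{x, y, z, t}"])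
next
  case (2 i x y z T)
  then show ?thesis
    by (auto intro!: short_edge_mem[where T = T] long_edge_mem[where T = T])
qed

lemma octa_cocycle_face:
  assumes "es \<in> face_cycles (octahedra D)"
  shows "foldr (**) (map oc es) (mat 1) = mat 1"
proof -
  have det: "\<forall>(i, u, v)\<in>set es. det (octa_mat D w r q i u) = 1 \<and> det (octa_mat D w r q i v) = 1"
    using det_octa_mat_edge face_cycle_edges[OF assms] by blast
  from assms show ?thesis
  proof (cases rule: face_cycle_cases)
    case (1 i x y z t)
    with det show ?thesis by (simp add: octa_cocycle_trans octa_cocycle_refl)
  next
    case (2 i x y z T)
    with det show ?thesis by (simp add: octa_cocycle_trans octa_cocycle_refl)
  qed
qed

text \<open>Reversal respects the gluing and hence maps classes into classes, so it descends to the
  exterior.\<close>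

lemma edge_class_rev:
  assumes "e \<in> octa_edges D"
  shows "edge_rev (octahedra D) ` edge_class D e = edge_class D (edge_rev (octahedra D) e)"
proof -
  define rv :: "oedge \<Rightarrow> oedge" where "rv = (\<lambda>(i, u, v). (i, v, u))"
  have rv_rv: "rv (rv e) = e" for e by (simp add: rv_def split: prod.splits)
  have rv_edge: "rv e \<in> octa_edges D" if "e \<in> octa_edges D" for e
    using that octa_edges_rev by (auto simp: rv_def split: prod.splits)
  have glued: "glued D (rv e) (rv e')" if g: "glued D e e'" for e e'
  proof -
    have edges: "rv e \<in> octa_edges D" "rv e' \<in> octa_edges D"
      using g rv_edge by (simp_all add: glued_def)
    obtain i s j t x y z u x' y' z' u' where "(i, s) \<in> darts D" "opp D (i, s) = (j, t)"
      and e: "e = (i, (x, y), (z, u))" and face: "{x, y, z, u} \<subseteq> left_face s"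
      and e': "e' = (j, (x', y'), (z', u'))" and face': "{x', y', z', u'} \<subseteq> right_face t"
      and types: "map vert_type [x, y, z, u] = map vert_type [x', y', z', u']"
      using g unfolding glued_def by (elim conjE exE) (rule that)
    show ?thesis
      unfolding glued_def
    proof (intro conjI exI)
      show "rv e = (i, (z, u), (x, y))" "rv e' = (j, (z', u'), (x', y'))"
        by (simp_all add: rv_def e e')
      show "{z, u, x, y} \<subseteq> left_face s" "{z', u', x', y'} \<subseteq> right_face t"
        using face face' by auto
      show "map vert_type [z, u, x, y] = map vert_type [z', u', x', y']"
        using types by simp
    qed fact+
  qed
  have equiv: "equivclp (glued D) (rv e) (rv e')" if "equivclp (glued D) e e'" for e e'
    using that
    by (induction rule: equivclp_induct) (auto dest: glued intro: equivclp_trans equivclp_sym)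
  have sub: "rv ` edge_class D e \<subseteq> edge_class D (rv e)" if "e \<in> octa_edges D" for e
  proof (rule image_subsetI)
    fix e' assume "e' \<in> edge_class D e"
    then show "rv e' \<in> edge_class D (rv e)"
      using equiv[of e e'] rv_edge[of e] rv_edge[of e'] by (simp add: edge_class_def identified_def)
  qed
  \<comment> \<open>The opposite inclusion is \<open>sub\<close> for the reversed edge, since
    \<open>rv\<close> is an involution.\<close>
  have "edge_class D (rv e) = rv ` rv ` edge_class D (rv e)"
    by (simp add: image_image rv_rv)
  also have "\<dots> \<subseteq> rv ` edge_class D e"
    using sub[OF rv_edge[OF assms]] rv_rv by (metis image_mono)
  finally have "rv ` edge_class D e = edge_class D (rv e)"
    using sub[OF assms] by blast
  then show ?thesis
    by (simp add: octahedra_def rv_def)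
qed

text \<open>The chosen representative is immaterial on edge classes, because
  \<open>octa_cocycle_identified\<close> makes the projected matrix constant there.\<close>

definition exterior_cocycle :: "oedge set \<Rightarrow> (complex^2^2) set" where
  "exterior_cocycle E = to_PSL2 (oc (SOME e. e \<in> E))"

lemma exterior_cocycle_class:
  assumes "e \<in> octa_edges D"
  shows "exterior_cocycle (edge_class D e) = to_PSL2 (oc e)"
proof -
  have "e \<in> edge_class D e"
    using assms by (simp add: edge_class_def identified_def)
  then have "(SOME e'. e' \<in> edge_class D e) \<in> edge_class D e"
    by (rule someI)
  then show ?thesis
    using octa_cocycle_identified[of e "SOME e'. e' \<in> edge_class D e"]
    by (simp add: edge_class_def exterior_cocycle_def)
qed

text \<open>Every condition is checked on representatives in one octahedron, where it holds already
  in \<open>SL2\<close>, and then carried over by the homomorphism \<open>to_PSL2\<close>.\<close>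

lemma exterior_cocycle_natural: "natural_cocycle PSL2 to_PSL2 (exterior D) exterior_cocycle"
proof -
  have edges: "\<exists>e0\<in>octa_edges D. e = edge_class D e0"
    if "e \<in> short_edges (exterior D) \<union> long_edges (exterior D)" for e
    using that by (auto simp: exterior_def octa_edges_def)
  have carrier: "exterior_cocycle e \<in> carrier PSL2"
    if "e \<in> short_edges (exterior D) \<union> long_edges (exterior D)" for e
    using edges[OF that] by (auto simp: exterior_cocycle_class det_octa_cocycle to_PSL2_carrier)
  have rev: "exterior_cocycle e \<otimes>\<^bsub>PSL2\<^esub> exterior_cocycle (edge_rev (exterior D) e) = \<one>\<^bsub>PSL2\<^esub>"
    if e: "e \<in> short_edges (exterior D) \<union> long_edges (exterior D)" for e
  proof -
    obtain i u v where e0: "(i, u, v) \<in> octa_edges D" "e = edge_class D (i, u, v)"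
      using edges[OF e] by auto
    have "edge_rev (exterior D) e = edge_class D (i, v, u)"
      using edge_class_rev[OF e0(1)] by (simp add: exterior_def octahedra_def e0(2))
    then show ?thesis
      using e0 octa_edges_rev[OF e0(1)] det_octa_mat_edge[OF e0(1)]
      by (simp add: exterior_cocycle_class to_PSL2_mult det_octa_cocycle octa_cocycle_trans
          octa_cocycle_refl to_PSL2_one)
  qed
  have faces: "foldr (\<otimes>\<^bsub>PSL2\<^esub>) (map exterior_cocycle es) \<one>\<^bsub>PSL2\<^esub> = \<one>\<^bsub>PSL2\<^esub>"
    if es: "es \<in> face_cycles (exterior D)" for es
  proof -
    obtain fs where fs: "fs \<in> face_cycles (octahedra D)" "es = map (edge_class D) fs"
      using es by (auto simp: exterior_def)
    have "map exterior_cocycle es = map to_PSL2 (map oc fs)"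
      using face_cycle_edges[OF fs(1)] by (auto simp: fs(2) exterior_cocycle_class)
    moreover have "det A = 1" if "A \<in> set (map oc fs)" for A
      using that face_cycle_edges[OF fs(1)] det_octa_cocycle by auto
    ultimately show ?thesis
      using to_PSL2_foldr[of "map oc fs"] octa_cocycle_face[OF fs(1)] by (simp add: to_PSL2_one)
  qed
  have "exterior_cocycle e \<in> to_PSL2 ` unipotent" if "e \<in> short_edges (exterior D)" for e
    using that octa_cocycle_short_edge
    by (auto simp: exterior_def exterior_cocycle_class octa_edges_def)
  moreover have "exterior_cocycle e \<in> to_PSL2 ` counter_diagonal" if "e \<in> long_edges (exterior D)" for e
    using that octa_cocycle_long_edge
    by (auto simp: exterior_def exterior_cocycle_class octa_edges_def)
  ultimately show ?thesis
    using carrier rev faces unfolding natural_cocycle_def by blast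
qed

end

theorem theorem3p6:
  fixes D :: diagram and w :: "corner set \<Rightarrow> complex" and r q :: "nat \<Rightarrow> complex"
  assumes "knot_diagram D"
    and "region_variables D w"
    and "gluing_equations_T5 D w"
    and "\<And>i. i < crossings D \<Longrightarrow> (r i)^2 = eta D w i"
    and "\<And>i. i < crossings D \<Longrightarrow> q i \<noteq> 0"
    and "q_relations D w r q"
  shows "(\<forall>(e, e') \<in> identified D.
            to_PSL2 (octa_cocycle D w r q e) = to_PSL2 (octa_cocycle D w r q e')) \<and>
         (\<exists>\<B>. (\<forall>e \<in> octa_edges D. \<B> (edge_class D e) = to_PSL2 (octa_cocycle D w r q e)) \<and>
              natural_cocycle PSL2 to_PSL2 (exterior D) \<B>)"
proof -
  interpret glued_ptolemy D w r q
    using assms by unfold_locales (auto simp: knot_diagram_def)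
  show ?thesis
    using octa_cocycle_identified exterior_cocycle_class exterior_cocycle_natural by blast
qed

end
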